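(* Let the integers $K(n)$ and $L(n)$, $n\ge 0$, be defined by \[ \sum_{n\geq 0}K(n)q^n=f_1^2f_2^2f_7^2f_{14}^2,\qquad \sum_{n\geq 0}L(n)q^n=\frac{f_1^5f_7^5}{f_2f_{14}}. \] Then for all integers $n\geq 0$ and $\alpha\geq 1$, \[ K(7^\alpha n+7^\alpha -2)\equiv 0 \pmod{7^\alpha} \] and \[ L(7^\alpha n+7^\alpha -1)\equiv 0 \pmod{7^\alpha}. \]
   Context: For a positive integer $k$, $f_k:=(q^k;q^k)_\infty=\prod_{i\geq 1}(1-q^{ki})$, regarded as a formal power series in $q$ with integer coefficients (invertible, since its constant term is $1$). *)

theory Defs
  imports "HOL-Computational_Algebra.Formal_Power_Series" "HOL-Analysis.Infinite_Products"
    "HOL-Number_Theory.Cong"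
begin

(* The infinite product is a limit in the X-adic metric on formal power series. The index of
   prodinf starts at 0, hence Suc i. The value is meaningful only for k > 0. *)
definition euler_f :: "nat \<Rightarrow> int fps" where
  "euler_f k = prodinf (\<lambda>i. 1 - fps_X ^ (k * Suc i))"

(* The type int has no inverse operation, so inverse and (div) are not available for int fps.
   The second argument of fps_right_inverse is the inverse of the constant term. *)
definition euler_f_inv :: "nat \<Rightarrow> int fps" where
  "euler_f_inv k = fps_right_inverse (euler_f k) 1"

lemma euler_f_has_prod:
  assumes "k > 0"
  shows "(\<lambda>i. 1 - fps_X ^ (k * Suc i)) has_prod euler_f k"
proof -
  define P :: "nat \<Rightarrow> int fps" where "P = (\<lambda>n. \<Prod>i\<le>n. 1 - fps_X ^ (k * Suc i))"
  have P_step: "fps_nth (P (Suc n)) m = fps_nth (P n) m" if "m \<le> n" for n m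
  proof -
    have "Suc (Suc n) \<le> k * Suc (Suc n)"
      using assms by (cases k) simp_all
    with that have "m < k * Suc (Suc n)" by linarith
    moreover have "P (Suc n) = P n - P n * fps_X ^ (k * Suc (Suc n))"
      by (simp only: P_def prod.atMost_Suc right_diff_distrib mult_1_right)
    ultimately show ?thesis
      by (simp only: fps_sub_nth fps_X_power_mult_right_nth if_True diff_zero)
  qed
  have stable: "fps_nth (P n) m = fps_nth (P m) m" if "m \<le> n" for n m
    using that
  proof (induction n rule: dec_induct)
    case base
    show ?case ..
  next
    case (step n)
    then show ?case using P_step[of m n] by metis
  qed
  define A where "A = Abs_fps (\<lambda>m. fps_nth (P m) m)"
  have "P \<longlonglongrightarrow> A"
    by (rule tendsto_fpsI, rule eventually_sequentiallyI)
      (unfold A_def fps_nth_Abs_fps, rule stable)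
  moreover have "fps_nth A 0 = 1"
    using assms by (simp add: A_def P_def)
  ultimately have A: "(\<lambda>i. 1 - fps_X ^ (k * Suc i)) has_prod A"
    by (auto simp: has_prod_def raw_has_prod_def P_def)
  show ?thesis
    unfolding euler_f_def has_prod_unique[OF A, symmetric] by (rule A)
qed

lemma euler_f_LIMSEQ:
  assumes "k > 0"
  shows "(\<lambda>n. \<Prod>i\<le>n. 1 - fps_X ^ (k * Suc i)) \<longlonglongrightarrow> euler_f k"
proof -
  have "1 - fps_X ^ (k * Suc i) \<noteq> (0 :: int fps)" for i
  proof
    assume "1 - fps_X ^ (k * Suc i) = (0 :: int fps)"
    then have "fps_nth (1 - fps_X ^ (k * Suc i) :: int fps) 0 = fps_nth 0 0" by simp
    then show False using assms by simp
  qed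
  then show ?thesis
    using euler_f_has_prod[OF assms] by (auto simp: has_prod_def raw_has_prod_def)
qed

lemma euler_f_nth_0:
  assumes "k > 0"
  shows "fps_nth (euler_f k) 0 = 1"
proof -
  have "\<forall>\<^sub>F n in sequentially. fps_nth (\<Prod>i\<le>n. 1 - fps_X ^ (k * Suc i)) 0 = fps_nth (euler_f k) 0"
    using euler_f_LIMSEQ[OF assms] by (simp add: tendsto_fps_iff)
  moreover have "fps_nth (\<Prod>i\<le>n. 1 - fps_X ^ (k * Suc i) :: int fps) 0 = 1" for n
    using assms by (induction n) simp_all
  ultimately show ?thesis by simp
qed

lemma euler_f_inv_right:
  assumes "k > 0"
  shows "euler_f k * euler_f_inv k = 1"
  unfolding euler_f_inv_def
  by (rule fps_right_inverse) (simp add: euler_f_nth_0[OF assms])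

end

theory Submission
  imports Defs "HOL-Computational_Algebra.Formal_Laurent_Series"
begin

text \<open>
  Write \<open>f\<^sub>k\<close> for \<open>euler_f k\<close> and \<open>\<phi> = f\<^sub>1\<^sup>2 / f\<^sub>2\<close>. Both generating functions have the form
  \<open>P(q) P(q ^ 7)\<close>, where \<open>P = f\<^sub>c\<^sup>3 \<phi>\<close>: for \<open>K\<close> with \<open>c = 2\<close>, as \<open>P = f\<^sub>1\<^sup>2 f\<^sub>2\<^sup>2\<close>, and for \<open>L\<close> with \<open>c = 1\<close>, as
  \<open>P = f\<^sub>1\<^sup>5 / f\<^sub>2\<close>. The claim follows from a stronger fact: \<open>F = q ^ c P(q) P(q ^ 7)\<close> is an eigenvector with
  eigenvalue \<open>-7\<close> of the operator \<open>U\<^sub>7\<close> that sends \<open>\<Sum>n. a n * q ^ n\<close> to \<open>\<Sum>n. a (7 n) * q ^ n\<close>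
  (lemma \<open>section_7_eigenseries\<close>). Iteration gives \<open>a (7 ^ \<alpha> (n + 1)) = (-7) ^ \<alpha> a (n + 1)\<close> for the
  coefficients \<open>a\<close> of \<open>F\<close>, and \<open>K n = a (n + 2)\<close>, \<open>L n = a (n + 1)\<close> respectively.

  The eigenvector property reduces to \<open>U\<^sub>7 (q ^ c P(q)) = -7 q ^ c P(q ^ 7)\<close>, which can be read off from
  a double series. By Gauss and Jacobi (\<open>gauss_square_theta\<close>, \<open>jacobi_cube_theta\<close>),
  \<open>2 P = \<Sum>k l. (-1) ^ (k + l) * (2 k + 1) * q ^ (c k (k + 1) / 2 + l\<^sup>2)\<close>
  with \<open>k\<close> and \<open>l\<close> running over all integers. After the shift by \<open>c\<close>, the exponent is modulo 7 a unit
  times \<open>(2 k + 1)\<^sup>2 + (c l)\<^sup>2\<close>. As \<open>-1\<close> is not a square modulo 7, this is divisible by 7 only if both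
  \<open>2 k + 1\<close> and \<open>l\<close> are. The surviving terms form a copy of the whole series, scaled by 49 in
  the form and by \<open>-7\<close> in the weight (\<open>theta_product_section\<close>).

  Both theta series are limits of one finite version of Jacobi's triple product
  (\<open>theta_exponents.partial_theta_eq\<close>), a sum of Gaussian binomial coefficients with weights \<open>w\<close> subject to
  \<open>w (k - 1) + w (k + 1) = - 2 w k\<close>. The central coefficients with base \<open>q ^ k\<close> tend to \<open>1 / f\<^sub>k\<close>, so that the
  sums tend to the theta series divided by that Euler product.
\<close>

section \<open>Gaussian binomial coefficients\<close>

definition q_pochhammer :: "'a::comm_ring_1 \<Rightarrow> nat \<Rightarrow> 'a" where
  "q_pochhammer q n = (\<Prod>i<n. 1 - q ^ Suc i)"

lemma q_pochhammer_0 [simp]: "q_pochhammer q 0 = 1"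
  and q_pochhammer_Suc: "q_pochhammer q (Suc n) = q_pochhammer q n * (1 - q ^ Suc n)"
  by (simp_all add: q_pochhammer_def)

text \<open>
  The lower index is an integer, and the coefficient vanishes outside \<open>0..N\<close>. This makes the
  recurrences hold for every index, so that the bilateral sums below can be shifted without any
  boundary terms.
\<close>

fun q_binomial :: "'a::comm_ring_1 \<Rightarrow> nat \<Rightarrow> int \<Rightarrow> 'a" where
  "q_binomial q 0 j = (if j = 0 then 1 else 0)"
| "q_binomial q (Suc N) j = q_binomial q N (j - 1) + q ^ nat j * q_binomial q N j"

lemma q_binomial_eq_0: "j < 0 \<or> j > int N \<Longrightarrow> q_binomial q N j = 0"
  by (induction N arbitrary: j) auto

text \<open>
  The mirror image of the defining Pascal rule. The truncation by \<open>nat\<close> is harmless: whenever an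
  exponent would be negative, the coefficient next to it is zero.
\<close>

lemma q_binomial_Suc':
  "q_binomial q (Suc N) j = q ^ nat (int N + 1 - j) * q_binomial q N (j - 1) + q_binomial q N j"
proof (induction N arbitrary: j)
  case 0
  show ?case by auto
next
  case (Suc N)
  have mid: "q ^ nat j * (q ^ nat (int N + 1 - j) * q_binomial q N (j - 1)) =
    q ^ nat (int N + 2 - j) * (q ^ nat (j - 1) * q_binomial q N (j - 1))"
  proof (cases "1 \<le> j \<and> j \<le> int N + 1")
    case True
    then have "nat j + nat (int N + 1 - j) = nat (int N + 2 - j) + nat (j - 1)" by linarith
    then show ?thesis by (simp only: mult.assoc [symmetric] power_add [symmetric])
  next
    case False
    then have "q_binomial q N (j - 1) = 0" by (intro q_binomial_eq_0) auto
    then show ?thesis by simp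
  qed
  have "q_binomial q (Suc (Suc N)) j
      = q_binomial q (Suc N) (j - 1) + q ^ nat j * q_binomial q (Suc N) j"
    by (rule q_binomial.simps)
  also have "\<dots> = q ^ nat (int N + 2 - j) * q_binomial q N (j - 2) + q_binomial q N (j - 1)
      + q ^ nat j * (q ^ nat (int N + 1 - j) * q_binomial q N (j - 1) + q_binomial q N j)"
    unfolding Suc[of j] Suc[of "j - 1"] by (simp add: algebra_simps)
  also have "\<dots> = q ^ nat (int N + 2 - j) * (q_binomial q N (j - 2) + q ^ nat (j - 1) * q_binomial q N (j - 1))
      + (q_binomial q N (j - 1) + q ^ nat j * q_binomial q N j)"
    using mid by (simp add: algebra_simps)
  also have "\<dots> = q ^ nat (int (Suc N) + 1 - j) * q_binomial q (Suc N) (j - 1) + q_binomial q (Suc N) j"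
    by (simp add: algebra_simps)
  finally show ?case .
qed

text \<open>
  Both Pascal rules applied in succession. Raising \<open>N\<close> by two and \<open>j\<close> by one preserves the
  symmetry about the centre, which is why the finite triple product advances in steps of two.
\<close>

lemma q_binomial_Suc_Suc:
  "q_binomial q (Suc (Suc N)) j = q ^ nat (int N + 2 - j) * q_binomial q N (j - 2)
     + (1 + q ^ Suc N) * q_binomial q N (j - 1) + q ^ nat j * q_binomial q N j"
proof -
  have mid: "q ^ nat j * (q ^ nat (int N + 1 - j) * q_binomial q N (j - 1)) =
    q ^ Suc N * q_binomial q N (j - 1)"
  proof (cases "1 \<le> j \<and> j \<le> int N + 1")
    case True
    then have "nat j + nat (int N + 1 - j) = Suc N" by linarith
    then show ?thesis by (simp only: mult.assoc [symmetric] power_add [symmetric])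
  next
    case False
    then have "q_binomial q N (j - 1) = 0" by (intro q_binomial_eq_0) auto
    then show ?thesis by simp
  qed
  have "q_binomial q (Suc (Suc N)) j
      = q_binomial q (Suc N) (j - 1) + q ^ nat j * q_binomial q (Suc N) j"
    by (rule q_binomial.simps)
  also have "\<dots> = q ^ nat (int N + 2 - j) * q_binomial q N (j - 2) + q_binomial q N (j - 1)
      + q ^ nat j * (q ^ nat (int N + 1 - j) * q_binomial q N (j - 1) + q_binomial q N j)"
    unfolding q_binomial_Suc'[of q N j] q_binomial_Suc'[of q N "j - 1"] by (simp add: algebra_simps)
  finally show ?thesis using mid by (simp add: algebra_simps)
qed

lemma q_binomial_pochhammer:
  "q_binomial q (j + r) (int j) * (q_pochhammer q j * q_pochhammer q r) = q_pochhammer q (j + r)"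
proof (induction "j + r" arbitrary: j r)
  case 0
  then show ?case by simp
next
  case (Suc N)
  let ?p = "q_pochhammer q" and ?b = "q_binomial q N"
  have *: "?b (int j - 1) * (?p j * ?p r) = (1 - q ^ j) * ?p N"
  proof (cases j)
    case 0
    then show ?thesis by (simp add: q_binomial_eq_0)
  next
    case (Suc i)
    with Suc.hyps(2) have "N = i + r" by simp
    then show ?thesis using Suc.hyps(1)[of i r] Suc by (simp add: q_pochhammer_Suc algebra_simps)
  qed
  have **: "?b (int j) * (?p j * ?p r) = (1 - q ^ r) * ?p N"
  proof (cases r)
    case 0
    with Suc.hyps(2) show ?thesis by (simp add: q_binomial_eq_0)
  next
    case (Suc i)
    with Suc.hyps(2) have "N = j + i" by simp
    then show ?thesis using Suc.hyps(1)[of j i] Suc by (simp add: q_pochhammer_Suc algebra_simps)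
  qed
  have "q_binomial q (j + r) (int j) * (?p j * ?p r)
      = ?b (int j - 1) * (?p j * ?p r) + q ^ j * (?b (int j) * (?p j * ?p r))"
    unfolding Suc.hyps(2)[symmetric] by (simp add: algebra_simps)
  also have "\<dots> = (1 - q ^ j * q ^ r) * ?p N"
    unfolding * ** by (simp add: algebra_simps)
  also have "q ^ j * q ^ r = q ^ Suc N"
    unfolding Suc.hyps(2) by (simp add: power_add)
  finally show ?case
    unfolding Suc.hyps(2)[symmetric] q_pochhammer_Suc by (simp add: mult.commute)
qed

section \<open>A finite triple product with symmetric weights\<close>

lemma sum_symmetric_interval_shift:
  fixes g :: "int \<Rightarrow> 'a::comm_monoid_add"
  assumes "\<And>k. \<bar>k\<bar> \<ge> int M \<Longrightarrow> g k = 0" "\<bar>s\<bar> \<le> 1"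
  shows "(\<Sum>k=-int M..int M. g (k + s)) = (\<Sum>k=-int M..int M. g k)"
proof -
  have "(\<Sum>k=-int M..int M. g (k + s)) = (\<Sum>k=-int M+s..int M+s. g k)"
    by (rule sum.reindex_bij_witness[where i = "\<lambda>k. k - s" and j = "\<lambda>k. k + s"]) auto
  also have "\<dots> = (\<Sum>k=-int M-1..int M+1. g k)"
    using assms by (intro sum.mono_neutral_left) auto
  also have "\<dots> = (\<Sum>k=-int M..int M. g k)"
    using assms by (intro sum.mono_neutral_right) auto
  finally show ?thesis .
qed

text \<open>
  In Jacobi's triple product
  \<open>\<Sum>k. z ^ k * q ^ E k\<close> the exponent \<open>E\<close> is a quadratic polynomial, and \<open>d n\<close> is the exponent in the
  \<open>n\<close>-th pair of factors \<open>(1 + z q ^ d n) (1 + q ^ d n / z)\<close>; for \<open>a = 1\<close> there is one more factor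
  \<open>1 + 1 / z\<close>. The case \<open>a = 0\<close> is Gauss's sum over squares, the case \<open>a = 1\<close> Jacobi's sum over triangular numbers.
  The assumptions carry a factor 2 to avoid halves.
\<close>

locale theta_exponents =
  fixes c a :: nat and E :: "int \<Rightarrow> nat" and d :: "nat \<Rightarrow> nat"
  assumes c_pos: "c > 0" and a_le_1: "a \<le> 1"
    and two_E: "2 * int (E k) = int c * (k * (k + int a))"
    and two_d: "2 * d n = c * (2 * n + a + 1)"
begin

text \<open>
  The next two identities match the powers of \<open>q\<close> in the two outer terms of
  \<open>q_binomial_Suc_Suc\<close> with the exponents of the neighbours of \<open>k\<close>.
\<close>

lemma step_up:
  assumes "k \<ge> - int (n + a + 1)"
  shows "E k + c * nat (int (n + a + 1) + k) = d n + E (k + 1)"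
proof -
  have "2 * int (E k + c * nat (int (n + a + 1) + k)) = 2 * int (d n + E (k + 1))"
    using assms arg_cong[OF two_d[of n], of int] two_E[of k] two_E[of "k + 1"]
    by (simp add: algebra_simps)
  then show ?thesis unfolding mult_cancel_left of_nat_eq_iff by simp
qed

lemma step_down:
  assumes "k \<le> int (n + 1)"
  shows "E k + c * nat (int (n + 1) - k) = d n + E (k - 1)"
proof -
  have "2 * int (E k + c * nat (int (n + 1) - k)) = 2 * int (d n + E (k - 1))"
    using assms arg_cong[OF two_d[of n], of int] two_E[of k] two_E[of "k - 1"]
    by (simp add: algebra_simps)
  then show ?thesis unfolding mult_cancel_left of_nat_eq_iff by simp
qed

definition partial_theta :: "'a::comm_ring_1 \<Rightarrow> (int \<Rightarrow> 'a) \<Rightarrow> nat \<Rightarrow> 'a" where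
  "partial_theta q w n =
     (\<Sum>k=-int (n + a)..int n. w k * (q ^ E k * q_binomial (q ^ c) (2 * n + a) (int n - k)))"

lemma partial_theta_superset:
  assumes "n + a \<le> M"
  shows "partial_theta q w n =
    (\<Sum>k=-int M..int M. w k * (q ^ E k * q_binomial (q ^ c) (2 * n + a) (int n - k)))"
  unfolding partial_theta_def using assms
  by (intro sum.mono_neutral_left) (auto simp: q_binomial_eq_0)

text \<open>
  Instead of the variable \<open>z\<close> the sum carries weights \<open>w\<close>. The recurrence replaces \<open>w k\<close> by
  \<open>(1 + q ^ (2 * d n)) * w k + q ^ d n * (w (k - 1) + w (k + 1))\<close>, so the hypothesis on \<open>w\<close> produces the
  square \<open>(1 - q ^ d n)\<^sup>2\<close>. The weights with this property are \<open>(-1) ^ k\<close> times a linear function of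
  \<open>k\<close>. Constant functions correspond to \<open>z = -1\<close>, and the others come from differentiation in \<open>z\<close>, which
  for \<open>a = 1\<close> is needed because \<open>1 + 1 / z\<close> vanishes at \<open>z = -1\<close>. One argument thus covers both the
  theta series of Gauss and the cube of Jacobi.
\<close>

lemma partial_theta_Suc:
  fixes q :: "'a::comm_ring_1"
  assumes w: "\<And>k. w (k - 1) + w (k + 1) = - 2 * w k"
  shows "partial_theta q w (Suc n) = partial_theta q w n * (1 - q ^ d n)\<^sup>2"
proof -
  define M where "M = Suc (n + a)"
  define B where "B k = q ^ E k * q_binomial (q ^ c) (2 * n + a) (int n - k)" for k
  have B0: "B k = 0" if "\<bar>k\<bar> \<ge> int M" for k
    using that unfolding M_def B_def by (subst q_binomial_eq_0) auto
  \<comment> \<open>Beyond the range of \<open>step_up\<close> and \<open>step_down\<close> the binomial coefficients on both sides vanish.\<close>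
  have up: "q ^ E k * ((q ^ c) ^ nat (int (2 * n + a) + 2 - (int n + 1 - k))
        * q_binomial (q ^ c) (2 * n + a) (int n + 1 - k - 2)) = q ^ d n * B (k + 1)" (is "?l = ?r") for k
  proof (cases "k \<ge> - int (n + a + 1)")
    case True
    have "?l = q ^ (E k + c * nat (int (n + a + 1) + k)) * q_binomial (q ^ c) (2 * n + a) (int n - (k + 1))"
      by (simp add: power_add power_mult algebra_simps)
    then show ?thesis unfolding step_up[OF True] B_def by (simp add: power_add algebra_simps)
  next
    case False
    then show ?thesis unfolding B_def by (simp add: q_binomial_eq_0)
  qed
  have down: "q ^ E k * ((q ^ c) ^ nat (int n + 1 - k)
        * q_binomial (q ^ c) (2 * n + a) (int n + 1 - k)) = q ^ d n * B (k - 1)" (is "?l = ?r") for k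
  proof (cases "k \<le> int (n + 1)")
    case True
    have "?l = q ^ (E k + c * nat (int (n + 1) - k)) * q_binomial (q ^ c) (2 * n + a) (int n - (k - 1))"
      by (simp add: power_add power_mult algebra_simps)
    then show ?thesis unfolding step_down[OF True] B_def by (simp add: power_add algebra_simps)
  next
    case False
    then show ?thesis unfolding B_def by (simp add: q_binomial_eq_0)
  qed
  have qd: "(q ^ c) ^ Suc (2 * n + a) = (q ^ d n)\<^sup>2"
    using two_d[of n] by (simp add: power_mult [symmetric] mult.commute flip: power_mult power_add)
  have "q ^ E k * q_binomial (q ^ c) (2 * Suc n + a) (int (Suc n) - k)
      = q ^ d n * (B (k + 1) + B (k - 1)) + (1 + (q ^ d n)\<^sup>2) * B k" for k
  proof -
    have "q ^ E k * q_binomial (q ^ c) (2 * Suc n + a) (int (Suc n) - k)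
      = q ^ E k * q_binomial (q ^ c) (Suc (Suc (2 * n + a))) (int n + 1 - k)"
      by (simp add: algebra_simps)
    also have "\<dots> = q ^ d n * B (k + 1) + (1 + (q ^ d n)\<^sup>2) * B k + q ^ d n * B (k - 1)"
      unfolding q_binomial_Suc_Suc distrib_left up down qd
      by (simp add: B_def algebra_simps)
    finally show ?thesis by (simp add: algebra_simps)
  qed
  then have "partial_theta q w (Suc n) = (\<Sum>k=-int M..int M.
      q ^ d n * (w (k + 1 - 1) * B (k + 1)) + q ^ d n * (w (k + - 1 + 1) * B (k + - 1))
      + (1 + (q ^ d n)\<^sup>2) * (w k * B k))"
    by (subst partial_theta_superset[where M = M], simp add: M_def)
      (intro sum.cong, auto simp: algebra_simps)
  also have "\<dots> = q ^ d n * (\<Sum>k=-int M..int M. w (k - 1) * B k)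
      + q ^ d n * (\<Sum>k=-int M..int M. w (k + 1) * B k)
      + (1 + (q ^ d n)\<^sup>2) * (\<Sum>k=-int M..int M. w k * B k)"
    unfolding sum.distrib sum_distrib_left[symmetric]
    by (subst sum_symmetric_interval_shift[where g = "\<lambda>k. w (k - 1) * B k"], simp add: B0, simp,
        subst sum_symmetric_interval_shift[where g = "\<lambda>k. w (k + 1) * B k"], simp_all add: B0)
  also have "\<dots> = (\<Sum>k=-int M..int M. q ^ d n * ((w (k - 1) + w (k + 1)) * B k)
      + (1 + (q ^ d n)\<^sup>2) * (w k * B k))"
    by (simp add: sum.distrib sum_distrib_left algebra_simps)
  also have "\<dots> = (\<Sum>k=-int M..int M. w k * B k * (1 - q ^ d n)\<^sup>2)"
    unfolding w by (intro sum.cong) (auto simp: algebra_simps power2_eq_square)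
  also have "\<dots> = partial_theta q w n * (1 - q ^ d n)\<^sup>2"
    by (subst partial_theta_superset[where M = M])
      (simp_all add: M_def B_def sum_distrib_right)
  finally show ?thesis .
qed

lemma partial_theta_eq:
  fixes q :: "'a::comm_ring_1"
  assumes w: "\<And>k. w (k - 1) + w (k + 1) = - 2 * w k"
  shows "partial_theta q w n = partial_theta q w 0 * (\<Prod>i<n. 1 - q ^ d i)\<^sup>2"
  by (induction n) (simp_all add: partial_theta_Suc[OF w] power_mult_distrib mult.assoc)

end

section \<open>Passage to the limit\<close>

lemma fps_mult_nth_agree:
  fixes A B :: "'a::semiring_0 fps"
  assumes "\<And>i. i \<le> m \<Longrightarrow> fps_nth A i = fps_nth A' i" "\<And>i. i \<le> m \<Longrightarrow> fps_nth B i = fps_nth B' i" "i \<le> m"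
  shows "fps_nth (A * B) i = fps_nth (A' * B') i"
  unfolding fps_mult_nth using assms by (intro sum.cong) auto

lemma tendsto_fps_mult:
  fixes A B :: "'a::ring fps"
  assumes "(f \<longlongrightarrow> A) F" "(g \<longlongrightarrow> B) F"
  shows "((\<lambda>x. f x * g x) \<longlongrightarrow> A * B) F"
proof (rule tendsto_fpsI)
  fix n
  have "\<forall>\<^sub>F x in F. \<forall>i\<in>{..n}. fps_nth (f x) i = fps_nth A i"
       "\<forall>\<^sub>F x in F. \<forall>i\<in>{..n}. fps_nth (g x) i = fps_nth B i"
    using assms unfolding tendsto_fps_iff by (auto intro!: eventually_ball_finite)
  then show "\<forall>\<^sub>F x in F. fps_nth (f x * g x) n = fps_nth (A * B) n"
    by eventually_elim (rule fps_mult_nth_agree[where m = n], auto)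
qed

lemma q_pochhammer_tendsto:
  assumes "k > 0"
  shows "q_pochhammer (fps_X ^ k) \<longlonglongrightarrow> euler_f k"
proof -
  have "(\<lambda>n. q_pochhammer (fps_X ^ k) (Suc n)) \<longlonglongrightarrow> euler_f k"
    using euler_f_LIMSEQ[OF assms]
    by (simp only: q_pochhammer_def lessThan_Suc_atMost power_mult)
  then show ?thesis by (rule LIMSEQ_imp_Suc)
qed

text \<open>
  A quantitative form of the convergence: the factors after the \<open>n\<close>-th one do not affect the
  coefficients up to \<open>n\<close>.
\<close>

lemma q_pochhammer_nth:
  assumes "k > 0" "m \<le> n"
  shows "fps_nth (q_pochhammer (fps_X ^ k) n) m = fps_nth (euler_f k) m"
proof -
  obtain N where N: "\<And>n. n \<ge> N \<Longrightarrow> fps_nth (q_pochhammer (fps_X ^ k) n) m = fps_nth (euler_f k) m"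
    using q_pochhammer_tendsto[OF assms(1)] unfolding tendsto_fps_iff eventually_sequentially by blast
  have "fps_nth (q_pochhammer (fps_X ^ k) r) m = fps_nth (q_pochhammer (fps_X ^ k) n :: int fps) m"
    if "n \<le> r" for r
    using that
  proof (induction r rule: dec_induct)
    case (step r)
    have "m < k * Suc r"
      using assms step.hyps by (cases k) auto
    moreover have "q_pochhammer (fps_X ^ k) (Suc r) =
        q_pochhammer (fps_X ^ k) r - q_pochhammer (fps_X ^ k) r * (fps_X ^ (k * Suc r) :: int fps)"
      by (simp only: q_pochhammer_Suc power_mult right_diff_distrib mult_1_right)
    ultimately have "fps_nth (q_pochhammer (fps_X ^ k) (Suc r)) m = fps_nth (q_pochhammer (fps_X ^ k) r :: int fps) m"
      by (simp only: fps_sub_nth fps_X_power_mult_right_nth if_True diff_zero)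
    with step.IH show ?case by simp
  qed simp
  from this[of "max n N"] N[of "max n N"] show ?thesis by simp
qed

text \<open>
  Central Gaussian binomial coefficients converge to \<open>1 / euler_f k\<close>. Up to the coefficient \<open>m\<close>, the
  identity \<open>q_binomial_pochhammer\<close> reads \<open>B * f * f = f\<close> with \<open>f = euler_f k\<close>, and one factor \<open>f\<close> can be cancelled.
\<close>

lemma q_binomial_nth:
  assumes "k > 0" "m \<le> j" "m \<le> r" "i \<le> m"
  shows "fps_nth (euler_f k * q_binomial (fps_X ^ k) (j + r) (int j)) i = fps_nth 1 i"
proof -
  let ?f = "euler_f k" and ?B = "q_binomial (fps_X ^ k) (j + r) (int j) :: int fps"
  have 1: "fps_nth (?B * (?f * ?f)) i = fps_nth ?f i" if "i \<le> m" for i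
  proof -
    have "fps_nth (?B * (?f * ?f)) i
      = fps_nth (?B * (q_pochhammer (fps_X ^ k) j * q_pochhammer (fps_X ^ k) r)) i"
      using assms that
      by (intro fps_mult_nth_agree[where m = m]) (simp_all add: q_pochhammer_nth)
    also have "\<dots> = fps_nth ?f i"
      unfolding q_binomial_pochhammer using assms that by (intro q_pochhammer_nth) auto
    finally show ?thesis .
  qed
  have "?f * ?B = ?f * ?B * (?f * euler_f_inv k)"
    unfolding euler_f_inv_right[OF assms(1)] by simp
  also have "\<dots> = ?B * (?f * ?f) * euler_f_inv k"
    by (simp only: ac_simps)
  finally have "?f * ?B = ?B * (?f * ?f) * euler_f_inv k" .
  then have "fps_nth (?f * ?B) i = fps_nth (?B * (?f * ?f) * euler_f_inv k) i"
    by (rule arg_cong)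
  also have "\<dots> = fps_nth (?f * euler_f_inv k) i"
    by (rule fps_mult_nth_agree[of m]) (use 1 assms in auto)
  finally show ?thesis using euler_f_inv_right[OF assms(1)] by simp
qed

text \<open>
  The formal sum \<open>\<Sum>i. v i * X ^ E i\<close>. It has this meaning when all fibres of \<open>E\<close> are finite.
\<close>

definition theta_series :: "('i \<Rightarrow> nat) \<Rightarrow> ('i \<Rightarrow> int) \<Rightarrow> int fps" where
  "theta_series E v = Abs_fps (\<lambda>m. \<Sum>i | E i = m. v i)"

lemma theta_series_nth [simp]: "fps_nth (theta_series E v) m = (\<Sum>i | E i = m. v i)"
  by (simp add: theta_series_def)

context theta_exponents begin

text \<open>
  Exponents of a bounded size have bounded indices; hence the fibres are finite, and for large \<open>n\<close>
  only central binomial coefficients contribute to a given coefficient of \<open>partial_theta\<close>.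
\<close>

lemma abs_le_exponent: "\<bar>k\<bar> \<le> int (E k) + 1"
proof -
  have a: "a = 0 \<or> a = 1" using a_le_1 by auto
  have nonneg: "k * (k + int a) \<ge> 0"
    using a by (cases "k \<ge> 0") (auto simp: mult_nonpos_nonpos)
  have "2 * \<bar>k\<bar> - 2 \<le> k * (k + int a)"
  proof (cases "a = 0")
    case True
    have "0 \<le> (\<bar>k\<bar> - 1)\<^sup>2" by simp
    then show ?thesis using True by (simp add: power2_eq_square algebra_simps)
  next
    case False
    with a have "a = 1" by simp
    moreover have "0 \<le> (k + 1) * (k + 2)"
      by (cases "k \<ge> -1") (auto intro: mult_nonneg_nonneg mult_nonpos_nonpos)
    moreover have "0 \<le> k * k - k + 2"
      using zero_le_square[of "2 * k - 1"] by (simp add: algebra_simps)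
    ultimately show ?thesis by (cases "k \<ge> 0") (simp_all add: algebra_simps)
  qed
  also have "\<dots> \<le> int c * (k * (k + int a))"
    using mult_right_mono[OF _ nonneg, of 1 "int c"] c_pos by simp
  finally show ?thesis unfolding two_E[symmetric] by linarith
qed

lemma finite_exponent_fibre: "finite {k. E k = m}"
proof (rule finite_subset)
  show "{k. E k = m} \<subseteq> {-(int m + 1)..int m + 1}"
  proof
    fix k assume "k \<in> {k. E k = m}"
    then show "k \<in> {-(int m + 1)..int m + 1}"
      using abs_le_exponent[of k] by (auto simp: abs_le_iff)
  qed
qed simp

lemma partial_theta_tendsto:
  "(\<lambda>n. euler_f c * partial_theta fps_X (\<lambda>k. fps_const (v k)) n) \<longlonglongrightarrow> theta_series E v"
proof (rule tendsto_fpsI, rule eventually_sequentiallyI)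
  fix m n :: nat
  assume n: "2 * m + 1 \<le> n"
  let ?I = "{-int (n + a)..int n}"
  let ?B = "\<lambda>k. q_binomial (fps_X ^ c) (2 * n + a) (int n - k) :: int fps"
  have coeff: "fps_nth (fps_X ^ E k * (euler_f c * ?B k)) m = (if E k = m then 1 else 0)" for k
  proof (cases "E k \<le> m")
    case True
    then have k: "\<bar>k\<bar> \<le> int m + 1" using abs_le_exponent[of k] by linarith
    define j where "j = nat (int n - k)"
    define r where "r = nat (int (n + a) + k)"
    have jr: "int n - k = int j" "2 * n + a = j + r" "m \<le> j" "m \<le> r"
      using k n unfolding j_def r_def by linarith+
    have "fps_nth (euler_f c * ?B k) (m - E k) = fps_nth 1 (m - E k)"
      unfolding jr(1,2) by (rule q_binomial_nth[OF c_pos jr(3,4)]) simp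
    then show ?thesis using True by (auto simp: fps_X_power_mult_nth)
  qed (auto simp: fps_X_power_mult_nth)
  have "euler_f c * partial_theta fps_X (\<lambda>k. fps_const (v k)) n
      = (\<Sum>k\<in>?I. fps_const (v k) * (fps_X ^ E k * (euler_f c * ?B k)))"
    unfolding partial_theta_def sum_distrib_left by (intro sum.cong) (auto simp: algebra_simps)
  then have "fps_nth (euler_f c * partial_theta fps_X (\<lambda>k. fps_const (v k)) n) m
      = (\<Sum>k\<in>?I. if E k = m then v k else 0)"
    by (simp add: fps_sum_nth coeff) (intro sum.cong, auto)
  also have "\<dots> = (\<Sum>k\<in>?I \<inter> {k. E k = m}. v k)"
    by (simp add: sum.inter_restrict)
  also have "?I \<inter> {k. E k = m} = {k. E k = m}"
  proof -
    have "k \<in> ?I" if "E k = m" for k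
      using abs_le_exponent[of k] n that by (auto simp: abs_le_iff)
    then show ?thesis by blast
  qed
  finally show "fps_nth (euler_f c * partial_theta fps_X (\<lambda>k. fps_const (v k)) n) m
      = fps_nth (theta_series E v) m" by simp
qed

end

section \<open>The theta series of Gauss and of Jacobi\<close>

definition alternating_sign :: "int \<Rightarrow> int" where
  "alternating_sign k = (if even k then 1 else - 1)"

definition triangular :: "int \<Rightarrow> nat" where
  "triangular k = nat (k * (k + 1) div 2)"

definition square :: "int \<Rightarrow> nat" where
  "square k = nat (k\<^sup>2)"

lemma int_square: "int (square k) = k\<^sup>2"
  by (simp add: square_def)

lemma two_triangular: "2 * int (triangular k) = k * (k + 1)"
proof -
  have "k * (k + 1) \<ge> 0"
    by (cases "k \<ge> 0") (auto simp: mult_nonpos_nonpos)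
  then show ?thesis by (simp add: triangular_def)
qed

interpretation square: theta_exponents 2 0 square "\<lambda>n. 2 * n + 1"
  by unfold_locales (simp_all add: int_square power2_eq_square)

lemma theta_exponents_triangular:
  assumes "c > 0"
  shows "theta_exponents c 1 (\<lambda>k. c * triangular k) (\<lambda>n. c * Suc n)"
proof
  fix k show "2 * int (c * triangular k) = int c * (k * (k + int 1))"
    using two_triangular[of k] by (simp add: algebra_simps)
qed (use assms in auto)

lemma q_pochhammer_double:
  "(\<Prod>i<n. 1 - q ^ (2 * i + 1)) * q_pochhammer (q\<^sup>2) n = q_pochhammer q (2 * n)"
proof (induction n)
  case (Suc n)
  have "(\<Prod>i<Suc n. 1 - q ^ (2 * i + 1)) * q_pochhammer (q\<^sup>2) (Suc n)
      = ((\<Prod>i<n. 1 - q ^ (2 * i + 1)) * q_pochhammer (q\<^sup>2) n) * (1 - q ^ Suc (2 * n)) * (1 - (q\<^sup>2) ^ Suc n)"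
    by (simp add: q_pochhammer_Suc mult.assoc mult.left_commute mult.commute)
  also have "\<dots> = q_pochhammer q (Suc (Suc (2 * n)))"
    unfolding Suc q_pochhammer_Suc power_mult[symmetric] by simp
  finally show ?case by simp
qed simp

text \<open>
  Gauss's \<open>\<Sum>k. (-1) ^ k * q ^ k\<^sup>2 = f\<^sub>1\<^sup>2 / f\<^sub>2\<close>. The finite triple product has the factors
  \<open>1 - q ^ (2 i + 1)\<close> with odd exponents; multiplying by \<open>(q\<^sup>2; q\<^sup>2)\<^sub>n\<close> twice supplies the even exponents.
\<close>

lemma gauss_square_theta: "euler_f 2 * theta_series square alternating_sign = (euler_f 1)\<^sup>2"
proof -
  define \<phi> where "\<phi> = theta_series square alternating_sign"
  define w :: "int \<Rightarrow> int fps" where "w = (\<lambda>k. fps_const (alternating_sign k))"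
  let ?P = "q_pochhammer (fps_X ^ 2) :: nat \<Rightarrow> int fps"
  have w: "w (k - 1) + w (k + 1) = - 2 * w k" for k
    by (auto simp: w_def alternating_sign_def fps_eq_iff numeral_fps_const simp flip: fps_const_neg)
  have "(\<lambda>n. euler_f 2 * square.partial_theta fps_X w n * (?P n * ?P n))
      \<longlonglongrightarrow> \<phi> * (euler_f 2 * euler_f 2)"
    unfolding w_def \<phi>_def
    by (intro tendsto_fps_mult square.partial_theta_tendsto q_pochhammer_tendsto) auto
  moreover have "euler_f 2 * square.partial_theta fps_X w n * (?P n * ?P n)
      = euler_f 2 * (q_pochhammer (fps_X ^ 1) (2 * n) * q_pochhammer (fps_X ^ 1) (2 * n))" for n
  proof -
    have "square.partial_theta fps_X w 0 = 1"
      by (simp add: square.partial_theta_def w_def alternating_sign_def square_def)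
    then have "square.partial_theta fps_X w n * (?P n * ?P n)
        = ((\<Prod>i<n. 1 - fps_X ^ (2 * i + 1)) * ?P n)\<^sup>2"
      unfolding square.partial_theta_eq[OF w, of fps_X n] by (simp add: power2_eq_square ac_simps)
    then show ?thesis
      unfolding q_pochhammer_double by (simp add: power2_eq_square mult.assoc)
  qed
  moreover have "(\<lambda>n. q_pochhammer (fps_X ^ 1) (2 * n)) \<longlonglongrightarrow> euler_f 1"
    by (rule filterlim_compose[OF q_pochhammer_tendsto])
      (auto intro!: filterlim_subseq strict_monoI)
  then have "(\<lambda>n. euler_f 2 * (q_pochhammer (fps_X ^ 1) (2 * n) * q_pochhammer (fps_X ^ 1) (2 * n)))
      \<longlonglongrightarrow> euler_f 2 * (euler_f 1 * euler_f 1)"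
    by (intro tendsto_fps_mult tendsto_const)
  ultimately have "\<phi> * (euler_f 2 * euler_f 2) = euler_f 2 * (euler_f 1 * euler_f 1)"
    by (simp only: LIMSEQ_unique)
  then have "euler_f 2 * (euler_f 2 * \<phi>) = euler_f 2 * (euler_f 1)\<^sup>2"
    by (simp only: power2_eq_square ac_simps)
  moreover have "euler_f 2 \<noteq> 0"
    using euler_f_nth_0[of 2] by auto
  ultimately show ?thesis unfolding \<phi>_def by simp
qed

definition odd_weight :: "int \<Rightarrow> int" where
  "odd_weight k = alternating_sign k * (2 * k + 1)"

text \<open>
  Jacobi's \<open>f\<^sup>3 = \<Sum>k\<ge>0. (-1) ^ k * (2 * k + 1) * q ^ (k (k + 1) / 2)\<close>. The factor 2 arises because the
  sum here runs over all integers, and \<open>k\<close> and \<open>- 1 - k\<close> give the same term.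
\<close>

lemma jacobi_cube_theta:
  assumes "c > 0"
  shows "theta_series (\<lambda>k. c * triangular k) odd_weight = 2 * euler_f c ^ 3"
proof -
  interpret theta_exponents c 1 "\<lambda>k. c * triangular k" "\<lambda>n. c * Suc n"
    by (rule theta_exponents_triangular[OF assms])
  define w :: "int \<Rightarrow> int fps" where "w = (\<lambda>k. fps_const (odd_weight k))"
  let ?P = "q_pochhammer (fps_X ^ c) :: nat \<Rightarrow> int fps"
  have w: "w (k - 1) + w (k + 1) = - 2 * w k" for k
  proof -
    have "w (k - 1) + w (k + 1) = fps_const (odd_weight (k - 1) + odd_weight (k + 1))"
      by (simp add: w_def)
    also have "odd_weight (k - 1) + odd_weight (k + 1) = - 2 * odd_weight k"
      by (simp add: odd_weight_def alternating_sign_def)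
    also have "fps_const (- 2 * odd_weight k) = - 2 * w k"
      by (simp add: w_def numeral_fps_const flip: fps_const_mult fps_const_neg)
    finally show ?thesis .
  qed
  have "{- 1..0::int} = {- 1, 0}" by auto
  then have "partial_theta fps_X w 0 = 2"
    unfolding partial_theta_def using assms by (simp add: w_def odd_weight_def alternating_sign_def triangular_def
      numeral_fps_const)
  then have "partial_theta fps_X w n = 2 * (?P n * ?P n)" for n
    unfolding partial_theta_eq[OF w, of fps_X n]
    by (simp add: q_pochhammer_def power2_eq_square flip: power_mult power_Suc)
  then have "(\<lambda>n. euler_f c * (2 * (?P n * ?P n))) \<longlonglongrightarrow> theta_series (\<lambda>k. c * triangular k) odd_weight"
    using partial_theta_tendsto[of odd_weight] unfolding w_def by simp
  moreover have "(\<lambda>n. euler_f c * (2 * (?P n * ?P n))) \<longlonglongrightarrow> euler_f c * (2 * (euler_f c * euler_f c))"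
    by (intro tendsto_fps_mult tendsto_const q_pochhammer_tendsto assms)
  ultimately show ?thesis
    using LIMSEQ_unique by (fastforce simp: power3_eq_cube ac_simps)
qed

section \<open>Operations on theta series\<close>

lemma euler_f_compose:
  assumes "k > 0" "d > 0"
  shows "euler_f k oo fps_X ^ d = euler_f (d * k)"
proof -
  have "q_pochhammer (fps_X ^ k) n oo fps_X ^ d = (q_pochhammer (fps_X ^ (d * k)) n :: int fps)" for n
    unfolding q_pochhammer_def using assms
    by (simp add: fps_compose_prod_distrib fps_compose_sub_distrib fps_compose_mult_distrib
      fps_compose_power[symmetric] power_mult)
  moreover have "(\<lambda>n. q_pochhammer (fps_X ^ k) n oo fps_X ^ d) \<longlonglongrightarrow> (euler_f k oo fps_X ^ d)"
    using q_pochhammer_tendsto[OF assms(1)] unfolding tendsto_fps_iff fps_nth_compose_X_power by auto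
  ultimately show ?thesis
    using q_pochhammer_tendsto[of "d * k"] assms LIMSEQ_unique by simp
qed

lemma theta_series_mult:
  assumes "\<And>m. finite {i. E i = m}" "\<And>m. finite {i. E' i = m}"
  shows "theta_series E v * theta_series E' v'
    = theta_series (\<lambda>(i, j). E i + E' j) (\<lambda>(i, j). v i * v' j)"
proof (rule fps_ext)
  fix m
  define P where "P = {(i, j). E i + E' j = m}"
  have fibre: "{x \<in> P. E (fst x) = r} = {i. E i = r} \<times> {j. E' j = m - r}" if "r \<le> m" for r
    using that by (auto simp: P_def)
  have "finite (\<Union>r\<le>m. {i. E i = r} \<times> {j. E' j = m - r})"
    using assms by auto
  then have fin: "finite P" by (rule finite_subset[rotated]) (auto simp: P_def)
  have "fps_nth (theta_series E v * theta_series E' v') m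
      = (\<Sum>r=0..m. \<Sum>x\<in>{x \<in> P. E (fst x) = r}. v (fst x) * v' (snd x))"
    unfolding fps_mult_nth
    by (intro sum.cong refl) (simp add: fibre sum_product sum.cartesian_product case_prod_unfold)
  also have "\<dots> = (\<Sum>x\<in>P. v (fst x) * v' (snd x))"
    using fin by (intro sum.group) (auto simp: P_def)
  finally show "fps_nth (theta_series E v * theta_series E' v') m
      = fps_nth (theta_series (\<lambda>(i, j). E i + E' j) (\<lambda>(i, j). v i * v' j)) m"
    by (simp add: P_def case_prod_unfold)
qed

lemma X_power_mult_theta_series:
  "fps_X ^ s * theta_series E v = theta_series (\<lambda>i. s + E i) v"
proof (rule fps_ext)
  fix n
  show "fps_nth (fps_X ^ s * theta_series E v) n = fps_nth (theta_series (\<lambda>i. s + E i) v) n"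
    unfolding fps_X_power_mult_nth theta_series_nth
    by (auto intro!: sum.cong)
qed

lemma theta_series_compose_X_power:
  assumes "d > 0"
  shows "theta_series E v oo fps_X ^ d = theta_series (\<lambda>i. d * E i) v"
proof (rule fps_ext)
  fix n
  show "fps_nth (theta_series E v oo fps_X ^ d) n = fps_nth (theta_series (\<lambda>i. d * E i) v) n"
  proof (cases "d dvd n")
    case True
    then have "d * E i = n \<longleftrightarrow> E i = n div d" for i using assms by auto
    then show ?thesis using True by (simp add: fps_nth_compose_X_power)
  next
    case False
    then have "{i. d * E i = n} = {}" by auto
    then show ?thesis using False by (simp add: fps_nth_compose_X_power)
  qed
qed

text \<open>
  The operator \<open>U\<^sub>d\<close>, which keeps the coefficients with index divisible by \<open>d\<close>, is linear over
  series in \<open>X ^ d\<close>.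
\<close>

lemma fps_nth_mult_compose_X_power:
  fixes A B :: "'a::comm_ring_1 fps"
  assumes "d > 0"
  shows "fps_nth (A * (B oo fps_X ^ d)) (d * n) = fps_nth (Abs_fps (\<lambda>m. fps_nth A (d * m)) * B) n"
proof -
  have "fps_nth ((B oo fps_X ^ d) * A) (d * n)
      = (\<Sum>i=0..d * n. (if d dvd i then fps_nth B (i div d) else 0) * fps_nth A (d * n - i))"
    unfolding fps_mult_nth fps_nth_compose_X_power ..
  also have "\<dots> = (\<Sum>i\<in>(\<lambda>j. d * j) ` {0..n}. (if d dvd i then fps_nth B (i div d) else 0) * fps_nth A (d * n - i))"
    using assms by (intro sum.mono_neutral_right) (auto elim!: dvdE)
  also have "\<dots> = (\<Sum>j=0..n. fps_nth B j * fps_nth A (d * (n - j)))"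
    using assms by (subst sum.reindex) (auto intro!: inj_onI simp: diff_mult_distrib2)
  also have "\<dots> = fps_nth (B * Abs_fps (\<lambda>m. fps_nth A (d * m))) n"
    unfolding fps_mult_nth by simp
  finally show ?thesis by (simp only: mult.commute)
qed

section \<open>Dissection modulo 7\<close>

text \<open>
  Since \<open>-1\<close> is not a square modulo 7, the form \<open>x\<^sup>2 + y\<^sup>2\<close> is anisotropic modulo 7.
\<close>

lemma seven_dvd_sum_squares:
  fixes x y :: int
  assumes "7 dvd x\<^sup>2 + y\<^sup>2"
  shows "7 dvd x \<and> 7 dvd y"
proof -
  have residue: "7 dvd z \<and> z\<^sup>2 mod 7 = 0 \<or> z\<^sup>2 mod 7 \<in> {1, 2, 4}" for z :: int
  proof -
    have "z mod 7 = 0 \<or> z mod 7 = 1 \<or> z mod 7 = 2 \<or> z mod 7 = 3 \<or> z mod 7 = 4 \<or> z mod 7 = 5 \<or> z mod 7 = 6"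
      by presburger
    moreover have "z\<^sup>2 mod 7 = (z mod 7)\<^sup>2 mod 7" by (simp add: power_mod)
    ultimately show ?thesis by (elim disjE) (simp_all add: dvd_eq_mod_eq_0)
  qed
  have "(x\<^sup>2 mod 7 + y\<^sup>2 mod 7) mod 7 = 0"
    using assms by (simp add: mod_add_eq dvd_eq_mod_eq_0)
  then show ?thesis using residue[of x] residue[of y] by auto
qed

text \<open>
  Up to a unit and multiples of 7, the quadratic polynomial is \<open>(2 k + 1)\<^sup>2 + (c l)\<^sup>2\<close>: completing the
  square gives \<open>c (2 k + 1)\<^sup>2 + 8 l\<^sup>2\<close>, and for both values of \<open>c\<close> the ratio of the two coefficients is a square modulo 7.
\<close>

lemma exponent_form_mod_7:
  fixes c k l :: int
  assumes "c = 1 \<or> c = 2" "7 dvd 2 * c + c * (k * (k + 1)) + 2 * l\<^sup>2"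
  shows "k mod 7 = 3 \<and> l mod 7 = 0"
proof -
  let ?Q = "2 * c + c * (k * (k + 1)) + 2 * l\<^sup>2"
  have "7 dvd (2 * k + 1)\<^sup>2 + (c * l)\<^sup>2"
  proof (cases "c = 1")
    case True
    then have "(2 * k + 1)\<^sup>2 + (c * l)\<^sup>2 = 4 * ?Q - 7 * (1 + l\<^sup>2)"
      by (simp add: power2_eq_square algebra_simps)
    then show ?thesis using assms(2) by (simp only: dvd_diff dvd_mult dvd_triv_left)
  next
    case False
    with assms(1) have "(2 * k + 1)\<^sup>2 + (c * l)\<^sup>2 = 2 * ?Q - 7 * 1"
      by (simp add: power2_eq_square algebra_simps)
    then show ?thesis using assms(2) by (simp only: dvd_diff dvd_mult dvd_triv_left)
  qed
  then have "7 dvd 2 * k + 1" "7 dvd c * l"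
    using seven_dvd_sum_squares by blast+
  then show ?thesis using assms(1) by (elim disjE; simp; presburger)
qed

definition theta_product :: "nat \<Rightarrow> int fps" where
  "theta_product c = theta_series (\<lambda>k. c * triangular k) odd_weight * theta_series square alternating_sign"

lemma theta_product_eq:
  assumes "c > 0"
  shows "theta_product c = theta_series (\<lambda>(k, l). c * triangular k + square l)
    (\<lambda>(k, l). odd_weight k * alternating_sign l)"
  unfolding theta_product_def
  by (intro theta_series_mult square.finite_exponent_fibre
    theta_exponents.finite_exponent_fibre[OF theta_exponents_triangular[OF assms]])

text \<open>
  The index pairs that contribute to the exponents divisible by 7 are exactly \<open>(7 k + 3, 7 l)\<close>. Under
  this substitution \<open>2 k + 1\<close> is multiplied by 7, the parity of \<open>k\<close> is reversed and that of
  \<open>l\<close> is kept, so the weight is multiplied by \<open>-7\<close>. The exponent \<open>c + c k (k + 1) / 2 + l\<^sup>2\<close> grows to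
  \<open>49\<close> times the old one minus \<open>42 c\<close>; the shift by \<open>c\<close> is what makes it divisible by 7.
\<close>

lemma theta_product_section:
  assumes c: "c = 1 \<or> c = 2"
  shows "fps_nth (fps_X ^ c * theta_product c) (7 * n)
    = - 7 * fps_nth (fps_X ^ c * (theta_product c oo fps_X ^ 7)) n"
proof -
  have c_pos: "c > 0" using c by auto
  define W where "W = (\<lambda>(k, l). odd_weight k * alternating_sign l)"
  define S where "S = {(k, l). c + (c * triangular k + square l) = 7 * n}"
  define T where "T = {(k, l). c + 7 * (c * triangular k + square l) = n}"
  have form: "2 * (int c + (int c * int (triangular k) + int (square l)))
      = 2 * int c + int c * (k * (k + 1)) + 2 * l\<^sup>2" for k l
    unfolding two_triangular[symmetric] int_square by simp
  have triangular_7: "triangular (7 * k + 3) = 49 * triangular k + 6" for k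
  proof -
    have "2 * int (triangular (7 * k + 3)) = 2 * int (49 * triangular k + 6)"
      unfolding two_triangular using two_triangular[of k] by (simp add: algebra_simps)
    then show ?thesis by simp
  qed
  have square_7: "square (7 * l) = 49 * square l" for l
    by (simp add: square_def power_mult_distrib nat_mult_distrib)
  have S_mod: "k mod 7 = 3 \<and> l mod 7 = 0" if "(k, l) \<in> S" for k l
  proof (rule exponent_form_mod_7)
    have "int c + (int c * int (triangular k) + int (square l)) = 7 * int n"
      using that unfolding S_def by (simp flip: of_nat_mult of_nat_add)
    then show "7 dvd 2 * int c + int c * (k * (k + 1)) + 2 * l\<^sup>2"
      unfolding form[symmetric] by simp
  qed (use c in auto)
  have "(\<Sum>x\<in>S. W x) = (\<Sum>x\<in>T. - 7 * W x)"
  proof (rule sum.reindex_bij_witness[where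
        j = "\<lambda>(k, l). (k div 7, l div 7)" and i = "\<lambda>(k, l). (7 * k + 3, 7 * l)"])
    fix x assume x: "x \<in> S"
    obtain k l where kl: "x = (k, l)" by (cases x)
    define k' l' where "k' = k div 7" and "l' = l div 7"
    have k: "k = 7 * k' + 3" and l: "l = 7 * l'"
      using S_mod[of k l] x mult_div_mod_eq[of 7 k] mult_div_mod_eq[of 7 l]
      unfolding kl k'_def l'_def by auto
    show "(case case x of (k, l) \<Rightarrow> (k div 7, l div 7) of (k, l) \<Rightarrow> (7 * k + 3, 7 * l)) = x"
      unfolding kl k l by simp
    show "(case x of (k, l) \<Rightarrow> (k div 7, l div 7)) \<in> T"
      using x unfolding kl S_def T_def k l
      by (simp add: triangular_7 square_7) (simp add: algebra_simps)
    show "- 7 * W (case x of (k, l) \<Rightarrow> (k div 7, l div 7)) = W x"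
      unfolding kl k l by (simp add: W_def odd_weight_def alternating_sign_def)
  next
    fix x assume x: "x \<in> T"
    show "(case case x of (k, l) \<Rightarrow> (7 * k + 3, 7 * l) of (k, l) \<Rightarrow> (k div 7, l div 7)) = x"
      by (cases x) simp
    show "(case x of (k, l) \<Rightarrow> (7 * k + 3, 7 * l)) \<in> S"
      using x unfolding S_def T_def by (cases x) (auto simp: triangular_7 square_7, simp_all add: algebra_simps)
  qed
  then show ?thesis
    unfolding theta_product_eq[OF c_pos] X_power_mult_theta_series theta_series_nth
      theta_series_compose_X_power[of 7, simplified] W_def[symmetric]
    by (simp add: S_def T_def case_prod_unfold sum_distrib_left)
qed

text \<open>
  Applying \<open>U\<^sub>7\<close> to \<open>X ^ c P(X) P(X ^ 7)\<close> only affects the factor \<open>X ^ c P(X)\<close>, which turns into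
  \<open>-7 X ^ c P(X ^ 7)\<close>, while \<open>P(X ^ 7)\<close> turns into \<open>P(X)\<close>. The two factors have changed
  places, so the series is an eigenvector of \<open>U\<^sub>7\<close>.
\<close>

lemma section_7_eigenseries:
  fixes P :: "int fps"
  assumes c: "c = 1 \<or> c = 2" and P: "2 * P = theta_product c"
  shows "fps_nth (fps_X ^ c * (P * (P oo fps_X ^ 7))) (7 ^ \<alpha> * n)
    = (- 7) ^ \<alpha> * fps_nth (fps_X ^ c * (P * (P oo fps_X ^ 7))) n"
proof -
  \<comment> \<open>The factor 2 from the bilateral cube series cancels in the coefficients.\<close>
  have two: "(2 :: int fps) = fps_const 2" by (simp add: numeral_fps_const)
  have "fps_nth (fps_X ^ c * P) (7 * n) = - 7 * fps_nth (fps_X ^ c * (P oo fps_X ^ 7)) n" for n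
  proof -
    have "2 * P oo fps_X ^ 7 = 2 * (P oo fps_X ^ 7)"
      by (simp add: two fps_compose_mult_distrib)
    then show ?thesis
      using theta_product_section[OF c, of n]
      unfolding P[symmetric] by (simp add: two mult.left_commute[of "fps_X ^ c"])
  qed
  then have U: "Abs_fps (\<lambda>m. fps_nth (fps_X ^ c * P) (7 * m)) = fps_const (- 7) * (fps_X ^ c * (P oo fps_X ^ 7))"
    by (simp add: fps_eq_iff)
  have step: "fps_nth (fps_X ^ c * (P * (P oo fps_X ^ 7))) (7 * n)
    = - 7 * fps_nth (fps_X ^ c * (P * (P oo fps_X ^ 7))) n" for n
  proof -
    have "fps_nth (fps_X ^ c * (P * (P oo fps_X ^ 7))) (7 * n)
        = fps_nth (fps_const (- 7) * (fps_X ^ c * (P oo fps_X ^ 7)) * P) n"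
      unfolding mult.assoc[symmetric] fps_nth_mult_compose_X_power[of 7, simplified] U[unfolded mult.assoc[symmetric]] ..
    also have "fps_const (- 7) * (fps_X ^ c * (P oo fps_X ^ 7)) * P
        = fps_const (- 7) * (fps_X ^ c * (P * (P oo fps_X ^ 7)))"
      by (simp only: ac_simps)
    finally show ?thesis by simp
  qed
  show ?thesis
    by (induction \<alpha>) (simp_all add: step mult.assoc)
qed

section \<open>The congruences\<close>

theorem theorem7:
  fixes K L :: "nat \<Rightarrow> int"
  assumes K: "Abs_fps K = euler_f 1 ^ 2 * euler_f 2 ^ 2 * euler_f 7 ^ 2 * euler_f 14 ^ 2"
    and L: "Abs_fps L = euler_f 1 ^ 5 * euler_f 7 ^ 5 * (euler_f_inv 2 * euler_f_inv 14)"
  shows "\<forall>n \<alpha> :: nat. \<alpha> \<ge> 1 \<longrightarrow>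
    [K (7 ^ \<alpha> * n + 7 ^ \<alpha> - 2) = 0] (mod 7 ^ \<alpha>) \<and>
    [L (7 ^ \<alpha> * n + 7 ^ \<alpha> - 1) = 0] (mod 7 ^ \<alpha>)"
proof (intro allI impI conjI)
  fix n \<alpha> :: nat
  assume \<alpha>: "\<alpha> \<ge> 1"
  have seven: "(7::nat) ^ \<alpha> \<ge> 7" using \<alpha> by (cases \<alpha>) auto
  define \<phi> where "\<phi> = theta_series square alternating_sign"
  have \<phi>: "euler_f 2 * \<phi> = euler_f 1 ^ 2"
    unfolding \<phi>_def by (rule gauss_square_theta)
  have "(euler_f 2 * \<phi>) oo fps_X ^ 7 = (euler_f 1)\<^sup>2 oo fps_X ^ 7"
    unfolding \<phi> ..
  then have \<phi>7: "euler_f 14 * (\<phi> oo fps_X ^ 7) = euler_f 7 ^ 2"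
    by (simp add: fps_compose_mult_distrib fps_compose_power[symmetric] euler_f_compose)
  have P: "2 * (euler_f c ^ 3 * \<phi>) = theta_product c" if "c > 0" for c
    unfolding theta_product_def jacobi_cube_theta[OF that] \<phi>_def by (simp only: ac_simps)
  have P7: "(euler_f c ^ 3 * \<phi>) oo fps_X ^ 7 = euler_f (7 * c) ^ 3 * (\<phi> oo fps_X ^ 7)" if "c > 0" for c
    using that by (simp add: fps_compose_mult_distrib fps_compose_power[symmetric] euler_f_compose)
  have divisible: "[J (7 ^ \<alpha> * n + 7 ^ \<alpha> - c) = 0] (mod 7 ^ \<alpha>)"
    if c: "c = 1 \<or> c = 2" and J: "Abs_fps J = euler_f c ^ 3 * \<phi> * (euler_f (7 * c) ^ 3 * (\<phi> oo fps_X ^ 7))"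
    for c J
  proof -
    have c_pos: "c > 0" using c by auto
    define F where "F = fps_X ^ c * Abs_fps J"
    have F: "F = fps_X ^ c * ((euler_f c ^ 3 * \<phi>) * ((euler_f c ^ 3 * \<phi>) oo fps_X ^ 7))"
      unfolding F_def J P7[OF c_pos] ..
    have "7 ^ \<alpha> * (n + 1) - c = 7 ^ \<alpha> * n + 7 ^ \<alpha> - c" "c \<le> 7 ^ \<alpha> * (n + 1)"
      using seven c by (auto simp: algebra_simps intro: trans_le_add1)
    then have "J (7 ^ \<alpha> * n + 7 ^ \<alpha> - c) = fps_nth F (7 ^ \<alpha> * (n + 1))"
      unfolding F_def fps_X_power_mult_nth by simp
    also have "\<dots> = (- 7) ^ \<alpha> * fps_nth F (n + 1)"
      unfolding F by (rule section_7_eigenseries[OF c P[OF c_pos]])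
    also have "(- 7) ^ \<alpha> = (- 1) ^ \<alpha> * (7 :: int) ^ \<alpha>"
      by (simp flip: power_mult_distrib)
    finally show ?thesis by (simp add: cong_0_iff)
  qed
  \<comment> \<open>Take \<open>c = 2\<close>: \<open>f\<^sub>1\<^sup>2 f\<^sub>2\<^sup>2 = f\<^sub>2\<^sup>3 \<phi>\<close>.\<close>
  show "[K (7 ^ \<alpha> * n + 7 ^ \<alpha> - 2) = 0] (mod 7 ^ \<alpha>)"
  proof (rule divisible)
    have "euler_f 2 ^ 3 * \<phi> * (euler_f (7 * 2) ^ 3 * (\<phi> oo fps_X ^ 7))
        = (euler_f 2 * \<phi>) * (euler_f 14 * (\<phi> oo fps_X ^ 7)) * (euler_f 2 ^ 2 * euler_f 14 ^ 2)"
      by (simp add: power2_eq_square power3_eq_cube ac_simps)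
    then show "Abs_fps K = euler_f 2 ^ 3 * \<phi> * (euler_f (7 * 2) ^ 3 * (\<phi> oo fps_X ^ 7))"
      unfolding K \<phi> \<phi>7 by (simp add: ac_simps)
  qed simp
  \<comment> \<open>Take \<open>c = 1\<close>: \<open>f\<^sub>1\<^sup>5 / f\<^sub>2 = f\<^sub>1\<^sup>3 \<phi>\<close>.\<close>
  show "[L (7 ^ \<alpha> * n + 7 ^ \<alpha> - 1) = 0] (mod 7 ^ \<alpha>)"
  proof (rule divisible)
    have "Abs_fps L = euler_f 1 ^ 3 * euler_f 7 ^ 3 * (euler_f 1 ^ 2 * euler_f 7 ^ 2)
        * (euler_f_inv 2 * euler_f_inv 14)"
      unfolding L by (simp add: numeral_eq_Suc ac_simps)
    also have "\<dots> = euler_f 1 ^ 3 * euler_f 7 ^ 3 * (\<phi> * (\<phi> oo fps_X ^ 7))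
        * ((euler_f 2 * euler_f_inv 2) * (euler_f 14 * euler_f_inv 14))"
      unfolding \<phi>[symmetric] \<phi>7[symmetric] by (simp only: ac_simps)
    also have "\<dots> = euler_f 1 ^ 3 * \<phi> * (euler_f (7 * 1) ^ 3 * (\<phi> oo fps_X ^ 7))"
      by (simp add: euler_f_inv_right ac_simps)
    finally show "Abs_fps L = euler_f 1 ^ 3 * \<phi> * (euler_f (7 * 1) ^ 3 * (\<phi> oo fps_X ^ 7))" .
  qed simp
qed

end
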